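(* Let $H=(a_1,a_2)\subset\mathbb{R}$ be a bounded open interval, $\mathcal{B}$ a finite index set, and $m\ge 2$ an integer. Assume (H5.1): for each $b\in\mathcal{B}$, $g_b\in C^m(\bar H)$, $\theta_b\in C^m(\bar H)$, $g_b(x)>0$ for all $x\in\bar H$, $\theta_b(H)\subset H$; and there exist an integer $\mu\ge1$ and a real $\kappa<1$ such that $|\theta_\omega(x)-\theta_\omega(y)|\le\kappa|x-y|$ for all $\omega\in\mathcal{B}_\mu$ and $x,y\in\bar H$. Let $s>0$ and define $$C_1=\sup_{\omega\in\mathcal{B}_\mu,x\in\bar H}\frac{|g_\omega'(x)|}{g_\omega(x)},\quad M_1=\frac{C_1s}{1-\kappa},\quad E_2=\sup_{\omega\in\mathcal{B}_\mu,x\in\bar H}|\theta_\omega''(x)|,$$ $$K_2=\sup_{\omega\in\mathcal{B}_\mu,x\in\bar H}\frac{|g_\omega''(x)g_\omega(x)-(1-s)[g_\omega'(x)]^2|}{[g_\omega(x)]^2}.$$ Let $v_s$ be the (unique up to positive scalar multiples) strictly positive eigenfunction of $\Lambda_s:C^m(\bar H)\to C^m(\bar H)$ with eigenvalue $r(\Lambda_s)$. Then $$\sup\Big\{\frac{|v_s''(x)|}{v_s(x)}:x\in\bar H\Big\}\le M_2:=\frac{sK_2+2sC_1M_1\kappa+M_1E_2}{1-\kappa^2}.$$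
   Context: For $\nu\ge1$, $\mathcal{B}_\nu=\{\omega=(b_1,\dots,b_\nu): b_j\in\mathcal{B}\}$. For $\omega=(b_1,\dots,b_\nu)$, $\theta_\omega=\theta_{b_\nu}\circ\cdots\circ\theta_{b_1}$ and $g_\omega(x)=g_{b_\nu}(\theta_{b_{\nu-1}}\circ\cdots\circ\theta_{b_1}(x))\cdots g_{b_2}(\theta_{b_1}(x))\,g_{b_1}(x)$. For $s\ge0$, $L_s:C(\bar H)\to C(\bar H)$ is $(L_sw)(x)=\sum_{b\in\mathcal{B}}[g_b(x)]^s w(\theta_b(x))$, and $\Lambda_s$ is the restriction of $L_s$ to the Banach space $C^m(\bar H)$ (real $C^m$ functions on $H$ whose derivatives of order $\le m$ extend continuously to $\bar H$); $r(\Lambda_s)$ is its spectral radius. *)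

theory Defs
  imports "HOL-Analysis.Analysis"
begin

text \<open>
  \<open>H\<close> is an open interval throughout. The functions of a real variable take values in an
  arbitrary normed space, so that \<open>C^m\<close> of the closure of \<open>H\<close> and the transfer operator are
  available both in their real version and, at value type complex, as its complexification.
\<close>

definition nth_deriv :: "nat \<Rightarrow> (real \<Rightarrow> 'a::real_normed_vector) \<Rightarrow> real \<Rightarrow> 'a" where
  "nth_deriv k f = ((\<lambda>h x. vector_derivative h (at x)) ^^ k) f"

text \<open>
  A member of \<open>Cm H m\<close> is a total function, but only its values on the closure of \<open>H\<close> matter.
  The first conjunct says that on the boundary of \<open>H\<close> it is the continuous extension of its
  restriction to \<open>H\<close>.
\<close>

definition Cm :: "real set \<Rightarrow> nat \<Rightarrow> (real \<Rightarrow> 'a::real_normed_vector) set" where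
  "Cm H m = {f. continuous_on (closure H) f \<and>
                (\<forall>k<m. \<forall>x\<in>H. nth_deriv k f differentiable (at x)) \<and>
                (\<forall>k\<le>m. \<exists>h. continuous_on (closure H) h \<and> (\<forall>x\<in>H. h x = nth_deriv k f x))}"

text \<open>
  The value at \<open>x\<close> in the closure of \<open>H\<close> of the continuous extension of the \<open>k\<close>-th derivative
  on \<open>H\<close>. At interior points this is the \<open>k\<close>-th derivative itself, for \<open>f\<close> in \<open>Cm H m\<close> and
  \<open>k \<le> m\<close>.
\<close>

definition cl_deriv :: "real set \<Rightarrow> nat \<Rightarrow> (real \<Rightarrow> 'a::real_normed_vector) \<Rightarrow> real \<Rightarrow> 'a" where
  "cl_deriv H k f x = Lim (at x within H) (nth_deriv k f)"

definition Cm_norm :: "real set \<Rightarrow> nat \<Rightarrow> (real \<Rightarrow> 'a::real_normed_vector) \<Rightarrow> real" where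
  "Cm_norm H m f = (\<Sum>k\<le>m. SUP x\<in>closure H. norm (cl_deriv H k f x))"

definition words :: "'b set \<Rightarrow> nat \<Rightarrow> 'b list set" where
  "words B \<nu> = {\<omega>. set \<omega> \<subseteq> B \<and> length \<omega> = \<nu>}"

text \<open>The head of the list is \<open>b\<^sub>1\<close>, whose map is applied first.\<close>

primrec theta_word :: "('b \<Rightarrow> real \<Rightarrow> real) \<Rightarrow> 'b list \<Rightarrow> real \<Rightarrow> real" where
  "theta_word \<theta> [] = id"
| "theta_word \<theta> (b # \<omega>) = theta_word \<theta> \<omega> \<circ> \<theta> b"

primrec g_word ::
  "('b \<Rightarrow> real \<Rightarrow> real) \<Rightarrow> ('b \<Rightarrow> real \<Rightarrow> real) \<Rightarrow> 'b list \<Rightarrow> real \<Rightarrow> real" where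
  "g_word g \<theta> [] = (\<lambda>x. 1)"
| "g_word g \<theta> (b # \<omega>) = (\<lambda>x. g_word g \<theta> \<omega> (\<theta> b x) * g b x)"

definition transfer_op ::
  "'b set \<Rightarrow> ('b \<Rightarrow> real \<Rightarrow> real) \<Rightarrow> ('b \<Rightarrow> real \<Rightarrow> real) \<Rightarrow> real
    \<Rightarrow> (real \<Rightarrow> 'a::real_vector) \<Rightarrow> real \<Rightarrow> 'a" where
  "transfer_op B g \<theta> s w x = (\<Sum>b\<in>B. (g b x powr s) *\<^sub>R w (\<theta> b x))"

text \<open>
  The spectrum of a real operator on \<open>C^m\<close> is that of its complexification, an operator \<open>T\<close> on
  complex-valued functions. Extensionality makes functions that agree on the closure of \<open>H\<close>
  equal, so that bijectivity has its usual meaning.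
\<close>

definition Cm_spectrum ::
  "real set \<Rightarrow> nat \<Rightarrow> ((real \<Rightarrow> complex) \<Rightarrow> real \<Rightarrow> complex) \<Rightarrow> complex set" where
  "Cm_spectrum H m T = {z.
     let X = Cm H m \<inter> extensional (closure H);
         A = (\<lambda>w. restrict (\<lambda>x. z * w x - T w x) (closure H))
     in \<not> (bij_betw A X X \<and>
           (\<exists>K. \<forall>f\<in>X. Cm_norm H m (inv_into X A f) \<le> K * Cm_norm H m f))}"

definition Cm_spectral_radius ::
  "real set \<Rightarrow> nat \<Rightarrow> ((real \<Rightarrow> complex) \<Rightarrow> real \<Rightarrow> complex) \<Rightarrow> real" where
  "Cm_spectral_radius H m T = (SUP z\<in>Cm_spectrum H m T. cmod z)"

end

theory Submission
  imports Defs
begin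

text \<open>
  Iterating the eigenvalue equation \<open>\<mu>\<close> times gives
  \<open>r\<^sup>\<mu> v = (\<Sum>\<omega>. g\<^sub>\<omega>\<^sup>s (v \<circ> \<theta>\<^sub>\<omega>))\<close>. Differentiating once, every summand of \<open>r\<^sup>\<mu> v'\<close> is at most
  \<open>s C\<^sub>1 + \<kappa> N\<^sub>1\<close> times the corresponding summand of \<open>r\<^sup>\<mu> v\<close>, where \<open>N\<^sub>1 = sup \<bar>v'\<bar> / v\<close> is finite by
  compactness; hence \<open>N\<^sub>1 \<le> s C\<^sub>1 + \<kappa> N\<^sub>1\<close>, that is, \<open>N\<^sub>1 \<le> M\<^sub>1\<close>. Differentiating twice gives
  \<open>N\<^sub>2 \<le> s K\<^sub>2 + 2 s C\<^sub>1 M\<^sub>1 \<kappa> + M\<^sub>1 E\<^sub>2 + \<kappa>\<^sup>2 N\<^sub>2\<close> for \<open>N\<^sub>2 = sup \<bar>v''\<bar> / v\<close> in the same way.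
\<close>

section \<open>Functions of class C^2 up to the boundary\<close>

text \<open>The derivatives are carried as explicit functions \<open>f1\<close> and
  \<open>f2\<close>: on \<open>H\<close> they are genuine two-sided derivatives, on the boundary
  they are the continuous extensions. Chain and product rules can thus be stated as formulas valid
  on the whole closure.\<close>

definition C2_on :: "real set \<Rightarrow> (real \<Rightarrow> real) \<Rightarrow> (real \<Rightarrow> real) \<Rightarrow> (real \<Rightarrow> real) \<Rightarrow> bool" where
  "C2_on H f f1 f2 \<longleftrightarrow>
     continuous_on (closure H) f \<and> continuous_on (closure H) f1 \<and> continuous_on (closure H) f2 \<and>
     (\<forall>x\<in>H. (f has_real_derivative f1 x) (at x) \<and> (f1 has_real_derivative f2 x) (at x))"

lemma C2_on_cong:
  assumes "C2_on H f f1 f2" "open H"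
    and "\<And>x. x \<in> closure H \<Longrightarrow> f x = g x"
    and "\<And>x. x \<in> closure H \<Longrightarrow> f1 x = g1 x"
    and "\<And>x. x \<in> closure H \<Longrightarrow> f2 x = g2 x"
  shows "C2_on H g g1 g2"
proof -
  have [simp]: "x \<in> H \<Longrightarrow> x \<in> closure H" for x
    using closure_subset by blast
  have "(g has_real_derivative g1 x) (at x)" "(g1 has_real_derivative g2 x) (at x)"
    if x: "x \<in> H" for x
  proof -
    have "(f has_real_derivative g1 x) (at x)" "(f1 has_real_derivative g2 x) (at x)"
      using assms x by (auto simp: C2_on_def)
    then show "(g has_real_derivative g1 x) (at x)" "(g1 has_real_derivative g2 x) (at x)"
      using x assms(2-4) by (auto elim!: has_field_derivative_transform_within_open)
  qed
  moreover have "continuous_on (closure H) g" "continuous_on (closure H) g1"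
      "continuous_on (closure H) g2"
    using assms by (auto simp: C2_on_def cong: continuous_on_cong)
  ultimately show ?thesis
    by (simp add: C2_on_def)
qed

text \<open>The witnesses are the continuous extensions that \<open>Cm\<close> provides for k = 1
  and k = 2. They agree with the iterated derivatives on the open set \<open>H\<close>, so
  differentiability transfers to them.\<close>

lemma Cm_imp_C2_on:
  fixes f :: "real \<Rightarrow> real"
  assumes f: "f \<in> Cm H m" and "m \<ge> 2" "open H"
  shows "\<exists>f1 f2. C2_on H f f1 f2"
proof -
  have m: "0 < m" "Suc 0 < m" "Suc 0 \<le> m" "Suc (Suc 0) \<le> m"
    using \<open>m \<ge> 2\<close> by auto
  obtain h1 where h1: "continuous_on (closure H) h1" "\<And>x. x \<in> H \<Longrightarrow> h1 x = nth_deriv 1 f x"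
    using f m unfolding Cm_def One_nat_def by blast
  obtain h2 where h2: "continuous_on (closure H) h2" "\<And>x. x \<in> H \<Longrightarrow> h2 x = nth_deriv 2 f x"
    using f m unfolding Cm_def numeral_2_eq_2 by blast
  have "(f has_real_derivative h1 x) (at x)" "(h1 has_real_derivative h2 x) (at x)"
    if x: "x \<in> H" for x
  proof -
    have "nth_deriv 0 f differentiable (at x)" "nth_deriv 1 f differentiable (at x)"
      using f m x unfolding Cm_def One_nat_def by blast+
    then have "(nth_deriv 0 f has_real_derivative nth_deriv 1 f x) (at x)"
        "(nth_deriv 1 f has_real_derivative nth_deriv 2 f x) (at x)"
      by (simp_all add: has_real_derivative_iff_has_vector_derivative vector_derivative_works
          nth_deriv_def numeral_2_eq_2)
    then show "(f has_real_derivative h1 x) (at x)" "(h1 has_real_derivative h2 x) (at x)"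
      using h1 h2 x \<open>open H\<close>
      by (auto simp: nth_deriv_def elim!: has_field_derivative_transform_within_open)
  qed
  then show ?thesis
    using f h1 h2 unfolding C2_on_def Cm_def by blast
qed

text \<open>Every point of the closure of an open set of reals is an accumulation point of that set,
  so the limit is unique; continuity of \<open>h\<close> on the closure identifies it. This
  evaluates \<open>cl_deriv\<close> at the endpoints too.\<close>

lemma Lim_within_eq_continuous_extension:
  fixes f h :: "real \<Rightarrow> real"
  assumes "continuous_on (closure H) h" "\<And>y. y \<in> H \<Longrightarrow> f y = h y" "open H" "x \<in> closure H"
  shows "Lim (at x within H) f = h x"
proof (rule tendsto_Lim)
  show "\<not> trivial_limit (at x within H)"
    using assms(3,4) by (cases "x \<in> H")
      (auto simp: trivial_limit_within closure_def interior_open interior_limit_point)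
  have "(h \<longlongrightarrow> h x) (at x within closure H)"
    using assms by (simp add: continuous_on_def)
  then have "(h \<longlongrightarrow> h x) (at x within H)"
    by (rule tendsto_within_subset[OF _ closure_subset])
  then show "(f \<longlongrightarrow> h x) (at x within H)"
    using assms(2) by (auto simp: tendsto_cong eventually_at_filter cong: Lim_cong_within)
qed

lemma C2_on_cl_deriv:
  assumes f: "C2_on H f f1 f2" and "open H" "x \<in> closure H"
  shows "cl_deriv H 1 f x = f1 x" "cl_deriv H 2 f x = f2 x"
proof -
  have 1: "nth_deriv 1 f y = f1 y" if "y \<in> H" for y
    using f that by (auto simp: C2_on_def nth_deriv_def vector_derivative_at
        has_real_derivative_iff_has_vector_derivative)
  have 2: "nth_deriv 2 f y = f2 y" if y: "y \<in> H" for y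
  proof -
    have "(f1 has_real_derivative f2 y) (at y)"
      using f y by (simp add: C2_on_def)
    then have "(nth_deriv 1 f has_real_derivative f2 y) (at y)"
      using 1 y \<open>open H\<close> by (auto elim!: has_field_derivative_transform_within_open)
    then show ?thesis
      by (simp add: nth_deriv_def numeral_2_eq_2 vector_derivative_at
          has_real_derivative_iff_has_vector_derivative)
  qed
  show "cl_deriv H 1 f x = f1 x" "cl_deriv H 2 f x = f2 x"
    unfolding cl_deriv_def using assms 1 2
    by (auto simp: C2_on_def intro!: Lim_within_eq_continuous_extension)
qed

lemma C2_on_cl_derivI:
  assumes "C2_on H f f1 f2" "open H"
  shows "C2_on H f (cl_deriv H 1 f) (cl_deriv H 2 f)"
  by (rule C2_on_cong[OF assms]) (simp_all only: C2_on_cl_deriv[OF assms])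

text \<open>Both families of derivatives coincide with \<open>cl_deriv\<close>. This later turns one
  identity between functions into identities between their first and second derivatives, endpoints
  included.\<close>

lemma C2_on_unique:
  assumes f: "C2_on H f f1 f2" and g: "C2_on H f g1 g2" and H: "open H" "x \<in> closure H"
  shows "f1 x = g1 x" "f2 x = g2 x"
  using C2_on_cl_deriv[OF f H] C2_on_cl_deriv[OF g H] by simp_all

section \<open>Differentiation rules up to the boundary\<close>

lemma C2_on_const: "C2_on H (\<lambda>x. c) (\<lambda>x. 0) (\<lambda>x. 0)"
  by (simp add: C2_on_def)

lemma C2_on_id: "C2_on H (\<lambda>x. x) (\<lambda>x. 1) (\<lambda>x. 0)"
  by (simp add: C2_on_def continuous_on_id)

lemma C2_on_mult:
  assumes "C2_on H f f1 f2" "C2_on H g g1 g2"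
  shows "C2_on H (\<lambda>x. f x * g x) (\<lambda>x. f1 x * g x + f x * g1 x)
           (\<lambda>x. f2 x * g x + 2 * f1 x * g1 x + f x * g2 x)"
  using assms unfolding C2_on_def
  by (auto intro!: continuous_intros derivative_eq_intros simp: algebra_simps)

lemma C2_on_sum:
  assumes "\<And>i. i \<in> I \<Longrightarrow> C2_on H (f i) (f1 i) (f2 i)"
  shows "C2_on H (\<lambda>x. \<Sum>i\<in>I. f i x) (\<lambda>x. \<Sum>i\<in>I. f1 i x) (\<lambda>x. \<Sum>i\<in>I. f2 i x)"
  using assms unfolding C2_on_def
  by (auto intro!: continuous_on_sum DERIV_sum)

lemma continuous_image_closure_subset:
  fixes t :: "real \<Rightarrow> real"
  assumes "continuous_on (closure H) t" "t ` H \<subseteq> H"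
  shows "t ` closure H \<subseteq> closure H"
  by (rule image_closure_subset[OF assms(1) closed_closure])
    (use assms(2) closure_subset in blast)

lemma C2_on_compose:
  assumes f: "C2_on H f f1 f2" and t: "C2_on H t t1 t2" "t ` H \<subseteq> H"
  shows "C2_on H (\<lambda>x. f (t x)) (\<lambda>x. f1 (t x) * t1 x) (\<lambda>x. f2 (t x) * (t1 x)\<^sup>2 + f1 (t x) * t2 x)"
proof -
  have cl: "t ` closure H \<subseteq> closure H"
    using t by (intro continuous_image_closure_subset) (auto simp: C2_on_def)
  have c: "continuous_on (closure H) (\<lambda>x. h (t x))" if "continuous_on (closure H) h"
    for h :: "real \<Rightarrow> real"
    using t cl that by (auto simp: C2_on_def intro: continuous_on_compose2)
  have d: "((\<lambda>x. h (t x)) has_real_derivative h' * t1 x) (at x)"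
    if "x \<in> H" "(h has_real_derivative h') (at (t x))" for h h' x
    using t that by (auto simp: C2_on_def intro: DERIV_chain2)
  have d2: "((\<lambda>x. f1 (t x) * t1 x) has_real_derivative f2 (t x) * (t1 x)\<^sup>2 + f1 (t x) * t2 x) (at x)"
    if "x \<in> H" for x
    using f t that
    by (auto simp: C2_on_def image_subset_iff power2_eq_square
        intro!: derivative_eq_intros d[of _ f1 "f2 (t x)"])
  show ?thesis
    using f t c d d2 unfolding C2_on_def by (auto intro!: continuous_intros)
qed

text \<open>With the logarithmic derivative \<open>a = s * g1 / g\<close> of
  \<open>g powr s\<close>, the second derivative is \<open>g powr s * (a' + a\<^sup>2)\<close>.
  Collecting the two squares of \<open>g1\<close> produces the factor \<open>1 - s\<close>, which is
  how the quotient in \<open>K2\<close> arises.\<close>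

lemma C2_on_powr:
  assumes g: "C2_on H g g1 g2" and pos: "\<And>x. x \<in> closure H \<Longrightarrow> g x > 0"
  shows "C2_on H (\<lambda>x. g x powr s) (\<lambda>x. g x powr s * (s * g1 x / g x))
           (\<lambda>x. g x powr s * (s * (g2 x * g x - (1 - s) * (g1 x)\<^sup>2) / (g x)\<^sup>2))"
proof -
  have c: "continuous_on (closure H) g" "continuous_on (closure H) g1" "continuous_on (closure H) g2"
    using g by (auto simp: C2_on_def)
  have nz: "\<forall>x\<in>closure H. g x \<noteq> 0"
    using pos by fastforce
  have d1: "((\<lambda>x. g x powr s) has_real_derivative g x powr s * (s * g1 x / g x)) (at x)"
    if x: "x \<in> H" for x
  proof -
    have "g x > 0" "(g has_real_derivative g1 x) (at x)"
      using x pos closure_subset[of H] g by (auto simp: C2_on_def)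
    then show ?thesis
      by (auto intro!: derivative_eq_intros simp: powr_diff field_simps)
  qed
  have d2: "((\<lambda>x. g x powr s * (s * g1 x / g x)) has_real_derivative
      g x powr s * (s * (g2 x * g x - (1 - s) * (g1 x)\<^sup>2) / (g x)\<^sup>2)) (at x)"
    if x: "x \<in> H" for x
  proof -
    have gx: "g x > 0" "(g has_real_derivative g1 x) (at x)" "(g1 has_real_derivative g2 x) (at x)"
      using x pos closure_subset[of H] g by (auto simp: C2_on_def)
    have "((\<lambda>x. s * g1 x / g x) has_real_derivative s * (g2 x * g x - (g1 x)\<^sup>2) / (g x)\<^sup>2) (at x)"
      using gx by (auto intro!: derivative_eq_intros simp: field_simps power2_eq_square)
    \<comment> \<open>The product rule yields the two summands belonging to \<open>a\<^sup>2\<close>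
      and \<open>a'\<close>; only their algebraic form is changed.\<close>
    from DERIV_mult[OF d1[OF x] this] show ?thesis
      by (rule back_subst[where P = "\<lambda>d. (_ has_real_derivative d) _"])
        (use gx in \<open>simp add: field_simps power2_eq_square\<close>)
  qed
  show ?thesis
    unfolding C2_on_def using c nz d1 d2 by (auto intro!: continuous_intros)
qed

text \<open>Inside \<open>H\<close> the difference quotients are bounded by \<kappa>, hence so is
  their limit; continuity of \<open>t1\<close> carries the bound to the boundary.\<close>

lemma Lipschitz_imp_C2_on_deriv_le:
  assumes t: "C2_on H t t1 t2" and x: "x \<in> closure H"
    and lip: "\<And>x y. x \<in> closure H \<Longrightarrow> y \<in> closure H \<Longrightarrow> \<bar>t x - t y\<bar> \<le> \<kappa> * \<bar>x - y\<bar>" and "open H"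
  shows "\<bar>t1 x\<bar> \<le> \<kappa>"
proof (rule continuous_le_on_closure[OF _ x])
  show "continuous_on (closure H) (\<lambda>x. \<bar>t1 x\<bar>)"
    using t by (auto simp: C2_on_def intro!: continuous_intros)
  show "\<bar>t1 y\<bar> \<le> \<kappa>" if y: "y \<in> H" for y
  proof (rule tendsto_upperbound)
    have "((\<lambda>z. (t z - t y) / (z - y)) \<longlongrightarrow> t1 y) (at y)"
      using t y by (auto simp: C2_on_def has_field_derivative_iff)
    then show "((\<lambda>z. \<bar>(t z - t y) / (z - y)\<bar>) \<longlongrightarrow> \<bar>t1 y\<bar>) (at y)"
      by (rule tendsto_rabs)
    have "eventually (\<lambda>z. z \<in> H) (at y)"
      using \<open>open H\<close> y by (rule eventually_at_in_open')
    moreover have "eventually (\<lambda>z. z \<noteq> y) (at y)"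
      by (simp add: eventually_at_filter)
    ultimately show "eventually (\<lambda>z. \<bar>(t z - t y) / (z - y)\<bar> \<le> \<kappa>) (at y)"
    proof eventually_elim
      case (elim z)
      then have "\<bar>t z - t y\<bar> \<le> \<kappa> * \<bar>z - y\<bar>"
        using y closure_subset by (intro lip) auto
      with elim show ?case
        by (simp add: abs_divide divide_le_eq)
    qed
  qed simp
qed

section \<open>Words and iterates of the transfer operator\<close>

lemma words_0: "words B 0 = {[]}"
  by (auto simp: words_def)

lemma words_Suc: "words B (Suc n) = (\<lambda>(b, \<omega>). b # \<omega>) ` (B \<times> words B n)"
  by (force simp: words_def length_Suc_conv image_def)

lemma finite_words: "finite B \<Longrightarrow> finite (words B n)"
  by (induction n) (auto simp: words_0 words_Suc)

lemma words_nonempty: "B \<noteq> {} \<Longrightarrow> words B n \<noteq> {}"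
  by (induction n) (auto simp: words_0 words_Suc)

lemma theta_word_image_subset:
  assumes "\<And>b. b \<in> B \<Longrightarrow> \<theta> b ` S \<subseteq> S" "set \<omega> \<subseteq> B"
  shows "theta_word \<theta> \<omega> ` S \<subseteq> S"
  using assms(2)
proof (induction \<omega>)
  case (Cons b \<omega>)
  then have "\<theta> b ` S \<subseteq> S" "theta_word \<theta> \<omega> ` S \<subseteq> S"
    using assms(1) by auto
  then show ?case
    by auto
qed simp

lemma g_word_pos:
  assumes "\<And>b. b \<in> B \<Longrightarrow> \<theta> b ` S \<subseteq> S" "\<And>b x. b \<in> B \<Longrightarrow> x \<in> S \<Longrightarrow> g b x > 0"
    and "set \<omega> \<subseteq> B" "x \<in> S"
  shows "g_word g \<theta> \<omega> x > 0"
  using assms(3,4)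
proof (induction \<omega> arbitrary: x)
  case (Cons b \<omega>)
  moreover have "\<theta> b x \<in> S"
    using assms(1)[of b] Cons.prems by auto
  ultimately show ?case
    using assms(2) by simp
qed simp

text \<open>Induction on the word length, splitting off the first letter \<open>b\<close>. The
  cocycle rule for \<open>g_word\<close> lets \<open>g b x powr s\<close> be factored out, the inner
  sum is the induction hypothesis at \<open>\<theta> b x\<close>, and the remaining sum over
  \<open>b\<close> is one application of the operator at \<open>x\<close>.\<close>

lemma transfer_op_eigenfunction_words:
  fixes v :: "real \<Rightarrow> real"
  assumes theta: "\<And>b. b \<in> B \<Longrightarrow> \<theta> b ` S \<subseteq> S"
    and pos: "\<And>b x. b \<in> B \<Longrightarrow> x \<in> S \<Longrightarrow> g b x > 0"
    and eig: "\<And>x. x \<in> S \<Longrightarrow> transfer_op B g \<theta> s v x = r * v x"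
    and "x \<in> S"
  shows "(\<Sum>\<omega>\<in>words B n. g_word g \<theta> \<omega> x powr s * v (theta_word \<theta> \<omega> x)) = r ^ n * v x"
  using \<open>x \<in> S\<close>
proof (induction n arbitrary: x)
  case 0
  then show ?case
    by (simp add: words_0)
next
  case (Suc n)
  have inj: "inj_on (\<lambda>(b, \<omega>). b # \<omega>) (B \<times> words B n)"
    by (auto simp: inj_on_def)
  have "(\<Sum>\<omega>\<in>words B (Suc n). g_word g \<theta> \<omega> x powr s * v (theta_word \<theta> \<omega> x))
      = (\<Sum>b\<in>B. \<Sum>\<omega>\<in>words B n. (g_word g \<theta> \<omega> (\<theta> b x) * g b x) powr s * v (theta_word \<theta> \<omega> (\<theta> b x)))"
    unfolding words_Suc sum.reindex[OF inj]
    by (simp add: sum.cartesian_product o_def case_prod_unfold)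
  also have "\<dots> = (\<Sum>b\<in>B. g b x powr s * (\<Sum>\<omega>\<in>words B n.
      g_word g \<theta> \<omega> (\<theta> b x) powr s * v (theta_word \<theta> \<omega> (\<theta> b x))))"
  proof (intro sum.cong refl)
    fix b assume b: "b \<in> B"
    have "g_word g \<theta> \<omega> (\<theta> b x) > 0" if "\<omega> \<in> words B n" for \<omega>
      using that b theta[OF b] Suc.prems
      by (intro g_word_pos[where B = B and S = S, OF theta pos]) (auto simp: words_def)
    then show "(\<Sum>\<omega>\<in>words B n. (g_word g \<theta> \<omega> (\<theta> b x) * g b x) powr s * v (theta_word \<theta> \<omega> (\<theta> b x)))
        = g b x powr s * (\<Sum>\<omega>\<in>words B n. g_word g \<theta> \<omega> (\<theta> b x) powr s * v (theta_word \<theta> \<omega> (\<theta> b x)))"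
      using pos[OF b Suc.prems]
      by (auto simp: sum_distrib_left powr_mult less_imp_le intro!: sum.cong)
  qed
  also have "\<dots> = (\<Sum>b\<in>B. g b x powr s * (r ^ n * v (\<theta> b x)))"
    using Suc theta by (intro sum.cong refl) (subst Suc.IH; force)
  also have "\<dots> = r ^ n * transfer_op B g \<theta> s v x"
    by (simp add: transfer_op_def sum_distrib_left mult_ac)
  finally show ?case
    using eig Suc.prems by simp
qed

lemma C2_on_words:
  assumes theta: "\<And>b. b \<in> B \<Longrightarrow> \<exists>f1 f2. C2_on H (\<theta> b) f1 f2"
    and g: "\<And>b. b \<in> B \<Longrightarrow> \<exists>f1 f2. C2_on H (g b) f1 f2"
    and inv: "\<And>b. b \<in> B \<Longrightarrow> \<theta> b ` H \<subseteq> H"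
    and "set \<omega> \<subseteq> B"
  shows "(\<exists>f1 f2. C2_on H (theta_word \<theta> \<omega>) f1 f2) \<and> (\<exists>f1 f2. C2_on H (g_word g \<theta> \<omega>) f1 f2)"
  using \<open>set \<omega> \<subseteq> B\<close>
proof (induction \<omega>)
  case Nil
  show ?case
    using C2_on_const[of H 1] C2_on_id[of H] by (auto simp: id_def)
next
  case (Cons b \<omega>)
  then have b: "b \<in> B"
    by simp
  obtain t1 t2 g1 g2 where "C2_on H (\<theta> b) t1 t2" "C2_on H (g b) g1 g2"
    using theta[OF b] g[OF b] by blast
  moreover obtain T1 T2 G1 G2 where
    "C2_on H (theta_word \<theta> \<omega>) T1 T2" "C2_on H (g_word g \<theta> \<omega>) G1 G2"
    using Cons by auto
  ultimately show ?case
    using C2_on_compose[OF _ _ inv[OF b]] C2_on_mult by (simp add: o_def) blast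
qed

section \<open>Suprema, ratios and weighted sums\<close>

text \<open>A real supremum dominates its members only if the set is bounded above. Here the set is
  a finite union of continuous images of a compact set.\<close>

lemma le_SUP_finite_Times_compact:
  fixes h :: "'c \<Rightarrow> real \<Rightarrow> real"
  assumes "finite W" "compact S" "\<And>w. w \<in> W \<Longrightarrow> continuous_on S (h w)" "w \<in> W" "x \<in> S"
  shows "h w x \<le> (SUP (w, x)\<in>W \<times> S. h w x)"
proof -
  have "(\<lambda>(w, x). h w x) ` (W \<times> S) = (\<Union>w\<in>W. h w ` S)"
    by auto
  moreover have "bdd_above (\<Union>w\<in>W. h w ` S)"
    using assms by (simp add: bounded_imp_bdd_above compact_continuous_image compact_imp_bounded)
  ultimately have "bdd_above ((\<lambda>(w, x). h w x) ` (W \<times> S))"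
    by simp
  then show ?thesis
    using assms(4,5) by (auto intro!: cSUP_upper2[of _ _ "(w, x)"])
qed

text \<open>By compactness the supremum \<open>N\<close> of the ratio is finite. Feeding this
  \<open>N\<close> into the improvement hypothesis gives \<open>N \<le> A + q * N\<close>, which can
  be solved for \<open>N\<close> since \<open>q < 1\<close>.\<close>

lemma self_improving_ratio_bound:
  fixes v p :: "real \<Rightarrow> real"
  assumes "compact S" "continuous_on S v" "continuous_on S p" "\<And>x. x \<in> S \<Longrightarrow> v x > 0"
    and "\<And>N x. x \<in> S \<Longrightarrow> (\<And>y. y \<in> S \<Longrightarrow> \<bar>p y\<bar> \<le> N * v y) \<Longrightarrow> \<bar>p x\<bar> \<le> (A + q * N) * v x"
    and "q < 1" "x \<in> S"
  shows "\<bar>p x\<bar> / v x \<le> A / (1 - q)"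
proof -
  define N where "N = (SUP x\<in>S. \<bar>p x\<bar> / v x)"
  have "\<forall>x\<in>S. v x \<noteq> 0"
    using assms(4) by fastforce
  then have "continuous_on S (\<lambda>x. \<bar>p x\<bar> / v x)"
    using assms(2,3) by (auto intro!: continuous_intros)
  then have "bdd_above ((\<lambda>x. \<bar>p x\<bar> / v x) ` S)"
    using assms(1) by (simp add: bounded_imp_bdd_above compact_continuous_image compact_imp_bounded)
  then have N: "\<bar>p y\<bar> / v y \<le> N" if "y \<in> S" for y
    unfolding N_def using that by (rule cSUP_upper2) auto
  then have "\<bar>p y\<bar> \<le> N * v y" if "y \<in> S" for y
    using that assms(4) by (simp add: divide_le_eq)
  then have "\<bar>p y\<bar> / v y \<le> A + q * N" if "y \<in> S" for y
    using that assms(4,5) by (simp add: divide_le_eq)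
  then have "N \<le> A + q * N"
    unfolding N_def using \<open>x \<in> S\<close> by (intro cSUP_least) auto
  then have "N \<le> A / (1 - q)"
    using \<open>q < 1\<close> by (simp add: field_simps)
  then show ?thesis
    using N[OF \<open>x \<in> S\<close>] by linarith
qed

text \<open>Allows two sums with the same nonnegative weights to be compared term by term, with one
  common constant.\<close>

lemma abs_sum_weighted_le:
  fixes p d :: "'i \<Rightarrow> real"
  assumes "\<And>i. i \<in> I \<Longrightarrow> \<bar>d i\<bar> \<le> D * u i" "\<And>i. i \<in> I \<Longrightarrow> p i \<ge> 0"
  shows "\<bar>\<Sum>i\<in>I. p i * d i\<bar> \<le> D * (\<Sum>i\<in>I. p i * u i)"
proof -
  have "\<bar>\<Sum>i\<in>I. p i * d i\<bar> \<le> (\<Sum>i\<in>I. p i * \<bar>d i\<bar>)"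
    using assms(2) sum_abs[of "\<lambda>i. p i * d i" I] by (simp add: abs_mult)
  also have "\<dots> \<le> (\<Sum>i\<in>I. p i * (D * u i))"
    using assms by (intro sum_mono mult_left_mono) auto
  also have "\<dots> = D * (\<Sum>i\<in>I. p i * u i)"
    by (simp add: sum_distrib_left mult_ac)
  finally show ?thesis .
qed

theorem theorem5p2:
  fixes a1 a2 \<kappa> s C1 M1 E2 K2 M2 :: real
    and H :: "real set"
    and B :: "'b set"
    and m \<mu> :: nat
    and g \<theta> :: "'b \<Rightarrow> real \<Rightarrow> real"
    and v :: "real \<Rightarrow> real"
  assumes "a1 < a2" and H: "H = {a1<..<a2}"
    and "finite B" and "B \<noteq> {}"
    and "m \<ge> 2"
    and "\<forall>b\<in>B. g b \<in> Cm H m"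
    and "\<forall>b\<in>B. \<theta> b \<in> Cm H m"
    and "\<forall>b\<in>B. \<forall>x\<in>closure H. g b x > 0"
    and "\<forall>b\<in>B. \<theta> b ` H \<subseteq> H"
    and "\<mu> \<ge> 1" and "\<kappa> < 1"
    and "\<forall>\<omega>\<in>words B \<mu>. \<forall>x\<in>closure H. \<forall>y\<in>closure H.
           \<bar>theta_word \<theta> \<omega> x - theta_word \<theta> \<omega> y\<bar> \<le> \<kappa> * \<bar>x - y\<bar>"
    and "s > 0"
    and C1: "C1 = (SUP (\<omega>, x)\<in>words B \<mu> \<times> closure H.
           \<bar>cl_deriv H 1 (g_word g \<theta> \<omega>) x\<bar> / g_word g \<theta> \<omega> x)"
    and M1: "M1 = C1 * s / (1 - \<kappa>)"
    and E2: "E2 = (SUP (\<omega>, x)\<in>words B \<mu> \<times> closure H. \<bar>cl_deriv H 2 (theta_word \<theta> \<omega>) x\<bar>)"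
    and K2: "K2 = (SUP (\<omega>, x)\<in>words B \<mu> \<times> closure H.
           \<bar>cl_deriv H 2 (g_word g \<theta> \<omega>) x * g_word g \<theta> \<omega> x
              - (1 - s) * (cl_deriv H 1 (g_word g \<theta> \<omega>) x)\<^sup>2\<bar> / (g_word g \<theta> \<omega> x)\<^sup>2)"
    and M2: "M2 = (s * K2 + 2 * s * C1 * M1 * \<kappa> + M1 * E2) / (1 - \<kappa>\<^sup>2)"
    and "v \<in> Cm H m"
    and "\<forall>x\<in>closure H. v x > 0"
    and "\<forall>x\<in>closure H. transfer_op B g \<theta> s v x
           = Cm_spectral_radius H m (transfer_op B g \<theta> s) * v x"
  shows "(SUP x\<in>closure H. \<bar>cl_deriv H 2 v x\<bar> / v x) \<le> M2"
proof -

  \<comment> \<open>Regularity of the word functions and pointwise bounds from the suprema\<close>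
  let ?S = "closure H" and ?W = "words B \<mu>"
  let ?G = "g_word g \<theta>" and ?T = "theta_word \<theta>"
  let ?G1 = "\<lambda>\<omega>. cl_deriv H 1 (?G \<omega>)" and ?G2 = "\<lambda>\<omega>. cl_deriv H 2 (?G \<omega>)"
  let ?T1 = "\<lambda>\<omega>. cl_deriv H 1 (?T \<omega>)" and ?T2 = "\<lambda>\<omega>. cl_deriv H 2 (?T \<omega>)"
  let ?v1 = "cl_deriv H 1 v" and ?v2 = "cl_deriv H 2 v"
  define r where "r = Cm_spectral_radius H m (transfer_op B g \<theta> s)"
  have H': "open H" "compact ?S" "?S \<noteq> {}"
    using \<open>a1 < a2\<close> by (auto simp: H)
  have C2_Cm: "\<exists>f1 f2. C2_on H f f1 f2" if "f \<in> Cm H m" for f :: "real \<Rightarrow> real"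
    using that \<open>m \<ge> 2\<close> H'(1) by (rule Cm_imp_C2_on)
  have inv: "\<theta> b ` H \<subseteq> H" if "b \<in> B" for b
    using assms(9) that by blast
  have inv_closure: "\<theta> b ` ?S \<subseteq> ?S" if "b \<in> B" for b
    using assms(7) that by (intro continuous_image_closure_subset inv) (auto simp: Cm_def)
  have gpos: "g b x > 0" if "b \<in> B" "x \<in> ?S" for b x
    using assms(8) that by blast
  have vpos: "v x > 0" if "x \<in> ?S" for x
    using assms(20) that by blast
  have W: "finite ?W" "?W \<noteq> {}"
    using assms(3,4) finite_words words_nonempty by blast+
  \<comment> \<open>One word and one point are fixed as samples; evaluating there gives the signs of
    \<kappa>, \<open>C1\<close>, \<open>N\<close> and \<open>r ^ \<mu>\<close>.\<close>
  obtain \<omega>' x' where wx: "\<omega>' \<in> ?W" "x' \<in> ?S"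
    using W(2) H'(3) unfolding ex_in_conv[symmetric] by blast
  have GT: "C2_on H (?G \<omega>) (?G1 \<omega>) (?G2 \<omega>)" "C2_on H (?T \<omega>) (?T1 \<omega>) (?T2 \<omega>)"
    if "\<omega> \<in> ?W" for \<omega>
  proof -
    have "set \<omega> \<subseteq> B"
      using that by (simp add: words_def)
    then have "\<exists>f1 f2. C2_on H (?T \<omega>) f1 f2" "\<exists>f1 f2. C2_on H (?G \<omega>) f1 f2"
      using C2_on_words[of B H \<theta> g \<omega>] C2_Cm inv assms(6,7) by blast+
    then show "C2_on H (?G \<omega>) (?G1 \<omega>) (?G2 \<omega>)" "C2_on H (?T \<omega>) (?T1 \<omega>) (?T2 \<omega>)"
      using H'(1) C2_on_cl_derivI by blast+
  qed
  have v: "C2_on H v ?v1 ?v2"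
    using C2_Cm[OF assms(19)] H'(1) C2_on_cl_derivI by blast
  have Gpos: "?G \<omega> x > 0" if "\<omega> \<in> ?W" "x \<in> ?S" for \<omega> x
    using that inv_closure gpos by (intro g_word_pos[of B \<theta> ?S]) (auto simp: words_def)
  have Tcl: "?T \<omega> x \<in> ?S" if "\<omega> \<in> ?W" "x \<in> ?S" for \<omega> x
    using theta_word_image_subset[of B \<theta> ?S \<omega>] inv_closure that by (simp add: words_def image_subset_iff)
  have TH: "?T \<omega> ` H \<subseteq> H" if "\<omega> \<in> ?W" for \<omega>
    using that inv by (intro theta_word_image_subset[of B]) (auto simp: words_def)
  have T1: "\<bar>?T1 \<omega> x\<bar> \<le> \<kappa>" if "\<omega> \<in> ?W" "x \<in> ?S" for \<omega> x
    using Lipschitz_imp_C2_on_deriv_le[OF GT(2)[OF that(1)] that(2) _ H'(1)] assms(12) that(1)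
    by blast
  \<comment> \<open>The sign follows from \<kappa> bounding an absolute value. It is needed to
    square the bound on \<open>?T1\<close> and to get \<open>\<kappa>\<^sup>2 < 1\<close>.\<close>
  have \<kappa>: "0 \<le> \<kappa>"
    using T1[OF wx] by linarith
  have cont: "continuous_on ?S (?G \<omega>)" "continuous_on ?S (?G1 \<omega>)" "continuous_on ?S (?G2 \<omega>)"
      "continuous_on ?S (?T2 \<omega>)" if "\<omega> \<in> ?W" for \<omega>
    using GT[OF that] by (auto simp: C2_on_def)
  have nz: "?G \<omega> x \<noteq> 0" if "\<omega> \<in> ?W" "x \<in> ?S" for \<omega> x
    using Gpos that by fastforce
  have C1_ge: "\<bar>?G1 \<omega> x\<bar> / ?G \<omega> x \<le> C1" if "\<omega> \<in> ?W" "x \<in> ?S" for \<omega> x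
    unfolding C1
    by (rule le_SUP_finite_Times_compact[OF W(1) H'(2) _ that, where
          h = "\<lambda>\<omega> x. \<bar>?G1 \<omega> x\<bar> / ?G \<omega> x"])
      (use cont nz in \<open>auto intro!: continuous_intros\<close>)
  have E2_ge: "\<bar>?T2 \<omega> x\<bar> \<le> E2" if "\<omega> \<in> ?W" "x \<in> ?S" for \<omega> x
    unfolding E2
    by (rule le_SUP_finite_Times_compact[OF W(1) H'(2) _ that, where
          h = "\<lambda>\<omega> x. \<bar>?T2 \<omega> x\<bar>"])
      (use cont in \<open>auto intro!: continuous_intros\<close>)
  have K2_ge: "\<bar>?G2 \<omega> x * ?G \<omega> x - (1 - s) * (?G1 \<omega> x)\<^sup>2\<bar> / (?G \<omega> x)\<^sup>2 \<le> K2"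
    if "\<omega> \<in> ?W" "x \<in> ?S" for \<omega> x
    unfolding K2
    by (rule le_SUP_finite_Times_compact[OF W(1) H'(2) _ that, where
          h = "\<lambda>\<omega> x. \<bar>?G2 \<omega> x * ?G \<omega> x - (1 - s) * (?G1 \<omega> x)\<^sup>2\<bar> / (?G \<omega> x)\<^sup>2"])
      (use cont nz in \<open>auto intro!: continuous_intros\<close>)

  \<comment> \<open>The iterated eigenvalue equation, differentiated twice\<close>
  \<comment> \<open>The weight \<open>p\<close> is factored out of all derivatives:
    \<open>\<alpha>1\<close> and \<open>\<alpha>2\<close> are the first and second derivatives of
    \<open>p\<close> divided by \<open>p\<close>, and \<open>p * d1\<close>, \<open>p * d2\<close>
    are those of the summand \<open>p * (v \<circ> ?T \<omega>)\<close>. All three sums over words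
    then have the same positive weights.\<close>
  define p where "p \<omega> x = ?G \<omega> x powr s" for \<omega> x
  define \<alpha>1 where "\<alpha>1 \<omega> x = s * ?G1 \<omega> x / ?G \<omega> x" for \<omega> x
  define \<alpha>2 where "\<alpha>2 \<omega> x = s * (?G2 \<omega> x * ?G \<omega> x - (1 - s) * (?G1 \<omega> x)\<^sup>2) / (?G \<omega> x)\<^sup>2" for \<omega> x
  define d1 where "d1 \<omega> x = \<alpha>1 \<omega> x * v (?T \<omega> x) + ?v1 (?T \<omega> x) * ?T1 \<omega> x" for \<omega> x
  define d2 where "d2 \<omega> x = \<alpha>2 \<omega> x * v (?T \<omega> x) + 2 * \<alpha>1 \<omega> x * (?v1 (?T \<omega> x) * ?T1 \<omega> x)
      + (?v2 (?T \<omega> x) * (?T1 \<omega> x)\<^sup>2 + ?v1 (?T \<omega> x) * ?T2 \<omega> x)" for \<omega> x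
  have \<alpha>1: "\<bar>\<alpha>1 \<omega> x\<bar> \<le> s * C1" and \<alpha>2: "\<bar>\<alpha>2 \<omega> x\<bar> \<le> s * K2" if "\<omega> \<in> ?W" "x \<in> ?S" for \<omega> x
    using mult_left_mono[OF C1_ge[OF that], of s] mult_left_mono[OF K2_ge[OF that], of s]
      Gpos[OF that] \<open>s > 0\<close>
    by (simp_all add: \<alpha>1_def \<alpha>2_def abs_mult)
  have eq0: "(\<Sum>\<omega>\<in>?W. p \<omega> x * v (?T \<omega> x)) = r ^ \<mu> * v x" if "x \<in> ?S" for x
    unfolding p_def using assms(21)
    by (intro transfer_op_eigenfunction_words[OF inv_closure gpos _ that]) (auto simp: r_def)
  have "C2_on H (\<lambda>x. p \<omega> x * v (?T \<omega> x)) (\<lambda>x. p \<omega> x * d1 \<omega> x) (\<lambda>x. p \<omega> x * d2 \<omega> x)"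
    if "\<omega> \<in> ?W" for \<omega>
    using C2_on_mult[OF C2_on_powr[OF GT(1) Gpos] C2_on_compose[OF v GT(2) TH], OF that that _ that that, of s]
    by (rule C2_on_cong)
      (use H'(1) in \<open>auto simp: p_def d1_def d2_def \<alpha>1_def \<alpha>2_def algebra_simps\<close>)
  from C2_on_sum[of ?W, OF this]
  have "C2_on H (\<lambda>x. r ^ \<mu> * v x) (\<lambda>x. \<Sum>\<omega>\<in>?W. p \<omega> x * d1 \<omega> x) (\<lambda>x. \<Sum>\<omega>\<in>?W. p \<omega> x * d2 \<omega> x)"
    by (rule C2_on_cong) (use H'(1) eq0 in auto)
  moreover have "C2_on H (\<lambda>x. r ^ \<mu> * v x) (\<lambda>x. r ^ \<mu> * ?v1 x) (\<lambda>x. r ^ \<mu> * ?v2 x)"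
    using C2_on_mult[OF C2_on_const v, of "r ^ \<mu>"] by simp
  \<comment> \<open>The function \<open>r ^ \<mu> * v\<close> has been differentiated in two ways,
    directly and through the sum over words; uniqueness equates the results on the whole
    closure.\<close>
  ultimately have eq1: "r ^ \<mu> * ?v1 x = (\<Sum>\<omega>\<in>?W. p \<omega> x * d1 \<omega> x)"
    and eq2: "r ^ \<mu> * ?v2 x = (\<Sum>\<omega>\<in>?W. p \<omega> x * d2 \<omega> x)" if "x \<in> ?S" for x
    using C2_on_unique H'(1) that by blast+
  have p_pos: "p \<omega> x > 0" if "\<omega> \<in> ?W" "x \<in> ?S" for \<omega> x
    using Gpos[OF that] by (simp add: p_def)
  \<comment> \<open>A nonempty sum of positive terms equals \<open>r ^ \<mu> * v x'\<close>, and
    \<open>v x'\<close> is positive.\<close>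
  have "r ^ \<mu> > 0"
  proof -
    have "(\<Sum>\<omega>\<in>?W. p \<omega> x' * v (?T \<omega> x')) > 0"
      using wx W p_pos vpos Tcl by (intro sum_pos) auto
    then show ?thesis
      using eq0[OF wx(2)] vpos[OF wx(2)] by (simp add: zero_less_mult_iff)
  qed
  \<comment> \<open>Used for both derivatives: a bound of each \<open>d \<omega>\<close> by
    \<open>D * v (?T \<omega> x)\<close> sums to \<open>D * r ^ \<mu> * v x\<close> by
    \<open>eq0\<close>, and the factor \<open>r ^ \<mu>\<close> cancels.\<close>
  have bound: "\<bar>c\<bar> \<le> D * v x"
    if "x \<in> ?S" "r ^ \<mu> * c = (\<Sum>\<omega>\<in>?W. p \<omega> x * d \<omega>)"
      and "\<And>\<omega>. \<omega> \<in> ?W \<Longrightarrow> \<bar>d \<omega>\<bar> \<le> D * v (?T \<omega> x)" for c d D x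
  proof -
    have "\<bar>r ^ \<mu> * c\<bar> \<le> D * (r ^ \<mu> * v x)"
      using abs_sum_weighted_le[of ?W d D "\<lambda>\<omega>. v (?T \<omega> x)" "\<lambda>\<omega>. p \<omega> x"] that p_pos eq0
      by (simp add: less_imp_le)
    then have "r ^ \<mu> * \<bar>c\<bar> \<le> r ^ \<mu> * (D * v x)"
      using \<open>r ^ \<mu> > 0\<close> by (simp add: abs_mult mult_ac)
    then show ?thesis
      using \<open>r ^ \<mu> > 0\<close> by simp
  qed
  have vcont: "continuous_on ?S v" "continuous_on ?S ?v1" "continuous_on ?S ?v2"
    using v by (auto simp: C2_on_def)
  have N_nonneg: "N \<ge> 0" if "\<And>y. y \<in> ?S \<Longrightarrow> \<bar>f y\<bar> \<le> N * v y" for N f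
  proof -
    have "0 \<le> N * v x'"
      using that[OF wx(2)] by linarith
    then show ?thesis
      using vpos[OF wx(2)] by (simp add: zero_le_mult_iff)
  qed
  have C1_nonneg: "C1 \<ge> 0"
  proof -
    have "0 \<le> \<bar>?G1 \<omega>' x'\<bar> / ?G \<omega>' x'"
      using Gpos[OF wx] by simp
    then show ?thesis
      using C1_ge[OF wx] by linarith
  qed

  \<comment> \<open>First derivative\<close>
  have v1_ratio: "\<bar>?v1 x\<bar> / v x \<le> M1" if "x \<in> ?S" for x
    unfolding M1 mult.commute[of C1]
  \<comment> \<open>Here \<open>A = s * C1\<close> and \<open>q = \<kappa>\<close>: differentiating
    \<open>v \<circ> ?T \<omega>\<close> brings out one factor \<open>?T1\<close>, so the unknown
    ratio returns multiplied by \<kappa>.\<close>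
  proof (rule self_improving_ratio_bound[OF H'(2) vcont(1,2) vpos _ _ that])
    fix N x assume x: "x \<in> ?S" and N: "\<And>y. y \<in> ?S \<Longrightarrow> \<bar>?v1 y\<bar> \<le> N * v y"
    show "\<bar>?v1 x\<bar> \<le> (s * C1 + \<kappa> * N) * v x"
    proof (rule bound[OF x eq1[OF x]])
      fix \<omega> assume \<omega>: "\<omega> \<in> ?W"
      let ?y = "?T \<omega> x"
      have y: "?y \<in> ?S" "v ?y > 0"
        using Tcl vpos \<omega> x by auto
      have "\<bar>d1 \<omega> x\<bar> \<le> \<bar>\<alpha>1 \<omega> x\<bar> * v ?y + \<bar>?v1 ?y\<bar> * \<bar>?T1 \<omega> x\<bar>"
        unfolding d1_def using y by (intro order.trans[OF abs_triangle_ineq]) (simp add: abs_mult)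
      also have "\<dots> \<le> s * C1 * v ?y + N * v ?y * \<kappa>"
        using \<alpha>1[OF \<omega> x] N[OF y(1)] T1[OF \<omega> x] y by (intro add_mono mult_mono) auto
      finally show "\<bar>d1 \<omega> x\<bar> \<le> (s * C1 + \<kappa> * N) * v ?y"
        by (simp add: algebra_simps)
    qed
  qed (use \<open>\<kappa> < 1\<close> in auto)
  have v1_le: "\<bar>?v1 x\<bar> \<le> M1 * v x" if "x \<in> ?S" for x
    using v1_ratio[OF that] vpos[OF that] by (simp add: pos_divide_le_eq)
  have M1_nonneg: "M1 \<ge> 0"
    using N_nonneg v1_le by blast

  \<comment> \<open>Second derivative\<close>
  have "\<kappa>\<^sup>2 < 1"
    using \<kappa> \<open>\<kappa> < 1\<close> by (simp add: power_less_one_iff)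
  have "\<bar>?v2 x\<bar> / v x \<le> M2" if "x \<in> ?S" for x
    unfolding M2
  \<comment> \<open>Now \<open>q = \<kappa>\<^sup>2\<close>, because \<open>?v2\<close> comes with
    the square of \<open>?T1\<close>. The remaining terms contain only \<open>v\<close> and
    \<open>?v1\<close>, so they go into \<open>A\<close>.\<close>
  proof (rule self_improving_ratio_bound[OF H'(2) vcont(1,3) vpos _ _ that])
    fix N x assume x: "x \<in> ?S" and N: "\<And>y. y \<in> ?S \<Longrightarrow> \<bar>?v2 y\<bar> \<le> N * v y"
    show "\<bar>?v2 x\<bar> \<le> (s * K2 + 2 * s * C1 * M1 * \<kappa> + M1 * E2 + \<kappa>\<^sup>2 * N) * v x"
    proof (rule bound[OF x eq2[OF x]])
      fix \<omega> assume \<omega>: "\<omega> \<in> ?W"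
      let ?y = "?T \<omega> x"
      have y: "?y \<in> ?S" "v ?y > 0"
        using Tcl vpos \<omega> x by auto
      have T1sq: "(?T1 \<omega> x)\<^sup>2 \<le> \<kappa>\<^sup>2"
        using T1[OF \<omega> x] \<kappa> by (simp add: abs_le_square_iff[symmetric])
      have "\<bar>d2 \<omega> x\<bar> \<le> \<bar>\<alpha>2 \<omega> x\<bar> * v ?y + 2 * \<bar>\<alpha>1 \<omega> x\<bar> * (\<bar>?v1 ?y\<bar> * \<bar>?T1 \<omega> x\<bar>)
          + (\<bar>?v2 ?y\<bar> * (?T1 \<omega> x)\<^sup>2 + \<bar>?v1 ?y\<bar> * \<bar>?T2 \<omega> x\<bar>)"
        unfolding d2_def using y
        by (intro order.trans[OF abs_triangle_ineq] add_mono) (simp_all add: abs_mult)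
      \<comment> \<open>Term by term: \<open>K2\<close> bounds \<open>\<alpha>2\<close>; the mixed
        term uses \<open>C1\<close>, the bound \<open>M1\<close> just proved at the image point, and
        \<kappa>; the term with \<open>?T2\<close> uses \<open>M1\<close> and \<open>E2\<close>. The
        sign facts serve monotonicity of the products.\<close>
      also have "\<dots> \<le> s * K2 * v ?y + 2 * (s * C1) * (M1 * v ?y * \<kappa>)
          + (N * v ?y * \<kappa>\<^sup>2 + M1 * v ?y * E2)"
        using \<alpha>1[OF \<omega> x] \<alpha>2[OF \<omega> x] N[OF y(1)] T1[OF \<omega> x] T1sq v1_le[OF y(1)] E2_ge[OF \<omega> x] y
          \<kappa> M1_nonneg C1_nonneg N_nonneg[OF N] \<open>s > 0\<close>
        by (intro add_mono mult_mono) auto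
      finally show "\<bar>d2 \<omega> x\<bar> \<le> (s * K2 + 2 * s * C1 * M1 * \<kappa> + M1 * E2 + \<kappa>\<^sup>2 * N) * v ?y"
        by (simp add: algebra_simps)
    qed
  qed (use \<open>\<kappa>\<^sup>2 < 1\<close> in auto)
  then show ?thesis
    using H'(3) by (intro cSUP_least)
qed

end
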